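(* For every integer $n\ge 3$ there exists a convex $n$-gon $P\subset\mathbb{R}^2$ (a $2$-dimensional convex polytope with $n$ vertices) and $2n$ distinct orthogonal transformations $U$ of $\mathbb{R}^2$, of which $n$ are rotations and $n$ are reflections, such that $P=UP^\circ$ for each of them.
   Context: For $A\subseteq\mathbb{R}^d$, the polar is $A^\circ=\{x\in\mathbb{R}^d:\langle x,a\rangle\le 1\text{ for all }a\in A\}$. An orthogonal transformation is a linear map $U$ with $U^T=U^{-1}$. *)

theory Defs
  imports "HOL-Analysis.Analysis"
begin

definition polar :: "'a::euclidean_space set \<Rightarrow> 'a set" where
  "polar A = {x. \<forall>a\<in>A. x \<bullet> a \<le> 1}"

definition convex_ngon :: "nat \<Rightarrow> (real^2) set \<Rightarrow> bool" where
  "convex_ngon n P \<longleftrightarrow> polytope P \<and> aff_dim P = 2 \<and> card {v. v extreme_point_of P} = n"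

text \<open>Reflection in the hyperplane orthogonal to \<open>a\<close>; in the plane this is a line
  through the origin.\<close>

definition reflection_matrix :: "real^'d^'d \<Rightarrow> bool" where
  "reflection_matrix U \<longleftrightarrow> (\<exists>a. a \<noteq> 0 \<and> (\<forall>x. U *v x = x - (2 * (x \<bullet> a) / (a \<bullet> a)) *\<^sub>R a))"

end

theory Submission
  imports Defs
begin

text \<open>
  The polar of the regular \<open>n\<close>-gon with circumradius \<open>r\<close> centred at the origin is the
  regular \<open>n\<close>-gon with circumradius \<open>1 / (r * cos (pi / n))\<close>, turned by the angle \<open>pi / n\<close>.
  For \<open>r = 1 / sqrt (cos (pi / n))\<close> the two are congruent, and the orthogonal maps
  carrying one onto the other form a coset of the dihedral symmetry group of order \<open>2 * n\<close>.
\<close>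

section \<open>Polars, rotations and reflections\<close>

text \<open>For fixed \<open>x\<close> the bound \<open>x \<bullet> a \<le> 1\<close> describes a
  half-space of points \<open>a\<close>, so it passes from \<open>S\<close> to its hull.\<close>

lemma polar_convex_hull: "polar (convex hull S) = polar S"
proof
  show "polar (convex hull S) \<subseteq> polar S"
    using hull_subset[of S convex] by (auto simp: polar_def)
  show "polar S \<subseteq> polar (convex hull S)"
  proof
    fix x assume "x \<in> polar S"
    then have "S \<subseteq> {a. x \<bullet> a \<le> 1}" by (auto simp: polar_def)
    then have "convex hull S \<subseteq> {a. x \<bullet> a \<le> 1}"
      by (rule hull_minimal) (rule convex_halfspace_le)
    then show "x \<in> polar (convex hull S)" by (auto simp: polar_def)
  qed
qed

lemma polar_orthogonal_image:
  fixes f :: "'a::euclidean_space \<Rightarrow> 'a"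
  assumes "orthogonal_transformation f"
  shows "polar (f ` S) = f ` polar S"
proof
  show "f ` polar S \<subseteq> polar (f ` S)"
    using assms by (auto simp: polar_def orthogonal_transformation_def)
  show "polar (f ` S) \<subseteq> f ` polar S"
  proof
    fix y assume y: "y \<in> polar (f ` S)"
    obtain x where "y = f x"
      using orthogonal_transformation_surj[OF assms] by (metis surjD)
    with y assms show "y \<in> f ` polar S"
      by (auto simp: polar_def orthogonal_transformation_def)
  qed
qed

text \<open>Extreme points are the singleton faces, and injective linear maps preserve and reflect
  faces.\<close>

lemma extreme_points_linear_image:
  assumes "linear f" "inj f"
  shows "{v. v extreme_point_of (f ` S)} = f ` {v. v extreme_point_of S}"
proof -
  have "f x extreme_point_of (f ` S) \<longleftrightarrow> x extreme_point_of S" for x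
    using face_of_linear_image[OF assms, of "{x}" S] by (simp add: face_of_singleton)
  moreover have "v \<in> f ` S" if "v extreme_point_of (f ` S)" for v
    using that by (simp add: extreme_point_of_def)
  ultimately show ?thesis by blast
qed

section \<open>Unit circle points, plane rotations and plane reflections\<close>

definition circ :: "real \<Rightarrow> real^2" where
  "circ t = vector [cos t, sin t]"

definition rot_mat :: "real \<Rightarrow> real^2^2" where
  "rot_mat t = vector [vector [cos t, - sin t], vector [sin t, cos t]]"

text \<open>The mirror is the line through the origin at angle \<open>t / 2\<close> to the first
  axis.\<close>

definition refl_mat :: "real \<Rightarrow> real^2^2" where
  "refl_mat t = vector [vector [cos t, sin t], vector [sin t, - cos t]]"

lemma inner_circ: "circ s \<bullet> circ t = cos (s - t)"
  by (simp add: circ_def inner_vec_def sum_2 cos_diff)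

lemma norm_circ [simp]: "norm (circ t) = 1"
  by (simp add: norm_eq_sqrt_inner inner_circ)

lemma circ_eq_iff: "circ s = circ t \<longleftrightarrow> (\<exists>k::int. s = t + 2 * pi * k)"
  by (simp add: circ_def vec_eq_iff forall_2 sin_cos_eq_iff[symmetric] conj_commute)

lemma polar_coordinates:
  fixes x :: "real^2"
  obtains \<rho> t where "\<rho> \<ge> 0" "x = \<rho> *\<^sub>R circ t"
proof (cases "x = 0")
  case True
  then show ?thesis using that[of 0 0] by simp
next
  case False
  have nx: "(norm x)\<^sup>2 = (x$1)\<^sup>2 + (x$2)\<^sup>2"
    unfolding power2_norm_eq_inner by (simp add: inner_vec_def sum_2 power2_eq_square)
  have "(x$1 / norm x)\<^sup>2 + (x$2 / norm x)\<^sup>2 = 1"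
    using False by (simp add: power_divide nx[symmetric] add_divide_distrib[symmetric])
  then obtain t where t: "x$1 / norm x = cos t" "x$2 / norm x = sin t"
    by (rule sincos_total_2pi)
  have "x = norm x *\<^sub>R circ t"
    using False by (simp add: circ_def vec_eq_iff forall_2 t[symmetric])
  then show ?thesis by (rule that[OF norm_ge_zero])
qed

lemma rot_mat_circ: "rot_mat s *v circ t = circ (s + t)"
  by (simp add: rot_mat_def circ_def vec_eq_iff forall_2 matrix_vector_mult_def sum_2
      cos_add sin_add)

lemma refl_mat_circ: "refl_mat s *v circ t = circ (s - t)"
  by (simp add: refl_mat_def circ_def vec_eq_iff forall_2 matrix_vector_mult_def sum_2
      cos_diff sin_diff)

lemma det_rot_mat: "det (rot_mat t) = 1"
  by (simp add: rot_mat_def det_2 power2_eq_square[symmetric])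

lemma det_refl_mat: "det (refl_mat t) = - 1"
proof -
  have "det (refl_mat t) = - ((sin t)\<^sup>2 + (cos t)\<^sup>2)"
    by (simp add: refl_mat_def det_2 power2_eq_square)
  then show ?thesis by simp
qed

lemma orthogonal_rot_mat: "orthogonal_matrix (rot_mat t)"
  by (simp add: orthogonal_matrix rot_mat_def vec_eq_iff forall_2 matrix_matrix_mult_def
      transpose_def mat_def sum_2 power2_eq_square[symmetric])

lemma orthogonal_refl_mat: "orthogonal_matrix (refl_mat t)"
  by (simp add: orthogonal_matrix refl_mat_def vec_eq_iff forall_2 matrix_matrix_mult_def
      transpose_def mat_def sum_2 power2_eq_square[symmetric])

lemma rotation_rot_mat: "rotation_matrix (rot_mat t)"
  by (simp add: rotation_matrix_def orthogonal_rot_mat det_rot_mat)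

lemma reflection_refl_mat: "reflection_matrix (refl_mat t)"
proof -
  define u where "u = t / 2"
  \<comment> \<open>The unit normal of the mirror: \<open>circ u\<close> after a quarter
    turn.\<close>
  define a where "a = (vector [- sin u, cos u] :: real^2)"
  \<comment> \<open>Coordinate 1 of \<open>a\<close> is \<open>- sin u\<close> and coordinate 2 is
    \<open>cos u\<close>, so the first form of \<open>cos t\<close> suits coordinate 1 and the
    second suits coordinate 2.\<close>
  have t: "cos t = 1 - 2 * (sin u)\<^sup>2" "cos t = 2 * (cos u)\<^sup>2 - 1" "sin t = 2 * sin u * cos u"
    using cos_double_sin[of u] cos_double_cos[of u] sin_double[of u] by (simp_all add: u_def)
  have aa: "a \<bullet> a = 1"
    by (simp add: a_def inner_vec_def sum_2 power2_eq_square[symmetric])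
  have "refl_mat t *v x = x - (2 * (x \<bullet> a)) *\<^sub>R a" for x
  proof -
    have "(refl_mat t *v x) $ 1 = (x - (2 * (x \<bullet> a)) *\<^sub>R a) $ 1"
      by (simp add: refl_mat_def a_def matrix_vector_mult_def sum_2 inner_vec_def t(1,3))
         (simp add: algebra_simps power2_eq_square)
    moreover have "(refl_mat t *v x) $ 2 = (x - (2 * (x \<bullet> a)) *\<^sub>R a) $ 2"
      by (simp add: refl_mat_def a_def matrix_vector_mult_def sum_2 inner_vec_def t(2,3))
         (simp add: algebra_simps power2_eq_square)
    ultimately show ?thesis by (simp add: vec_eq_iff forall_2)
  qed
  then have "refl_mat t *v x = x - (2 * (x \<bullet> a) / (a \<bullet> a)) *\<^sub>R a" for x
    by (simp add: aa)
  moreover have "a \<noteq> 0" using aa by force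
  ultimately show ?thesis unfolding reflection_matrix_def by blast
qed

text \<open>Such a matrix is the identity minus \<open>c\<close> times the rank-one matrix with
  entries \<open>a $ i * a $ j\<close>. The quadratic terms of its determinant cancel, leaving
  \<open>1 - c * (a \<bullet> a)\<close>. This later separates reflections from rotations.\<close>

lemma det_reflection_matrix:
  fixes U :: "real^2^2"
  assumes "reflection_matrix U"
  shows "det U = - 1"
proof -
  obtain a where a: "a \<noteq> 0" and U: "U *v x = x - (2 * (x \<bullet> a) / (a \<bullet> a)) *\<^sub>R a" for x
    using assms unfolding reflection_matrix_def by blast
  define c where "c = 2 / (a \<bullet> a)"
  have entry: "U $ i $ j = axis j 1 $ i - c * a $ j * a $ i" for i j
    using U[of "axis j 1"]
    by (simp add: c_def vec_eq_iff column_def inner_axis' matrix_vector_mult_basis)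
  have "det U = 1 - c * (a$1 * a$1 + a$2 * a$2)"
    unfolding det_2 entry by (simp add: axis_def algebra_simps)
  also have "a$1 * a$1 + a$2 * a$2 = a \<bullet> a" by (simp add: inner_vec_def sum_2)
  finally show ?thesis using a by (simp add: c_def)
qed

section \<open>Regular polygons\<close>

text \<open>Even indices give the vertices of the polygon, odd indices the outward unit normals of
  its edges. Integer indices make shifts and negation bijective.\<close>

definition rvert :: "nat \<Rightarrow> int \<Rightarrow> real^2" where
  "rvert n m = circ (m * pi / n)"

definition even_verts :: "nat \<Rightarrow> (real^2) set" where
  "even_verts n = range (\<lambda>k. rvert n (2 * k))"

definition odd_verts :: "nat \<Rightarrow> (real^2) set" where
  "odd_verts n = range (\<lambda>k. rvert n (2 * k + 1))"

context
  fixes n :: nat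
  assumes n: "n \<ge> 3"
begin

section \<open>Signs, index arithmetic modulo \<open>2 * n\<close>, and counting vertices\<close>

lemma cos_pos: "cos (pi / n) > 0"
proof (rule cos_gt_zero)
  show "0 < pi / n" using n by simp
  show "pi / n < pi / 2" using n by (simp add: field_simps)
qed

lemma sin_pos: "sin (pi / n) > 0"
  using n by (intro sin_gt_zero) (simp_all add: field_simps)

lemma rvert_eq_iff: "rvert n l = rvert n m \<longleftrightarrow> l mod (2 * int n) = m mod (2 * int n)"
proof -
  have "l * pi / n = m * pi / n + 2 * pi * k \<longleftrightarrow> l = m + 2 * int n * k" for k :: int
  proof -
    have "l * pi / n = m * pi / n + 2 * pi * k \<longleftrightarrow> (real_of_int l) * pi = (m + 2 * n * k) * pi"
      using n by (simp add: field_simps)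
    also have "\<dots> \<longleftrightarrow> real_of_int l = real_of_int (m + 2 * int n * k)"
      by simp
    finally show ?thesis by (simp only: of_int_eq_iff)
  qed
  moreover have "l = m + 2 * int n * k \<longleftrightarrow> l - m = 2 * int n * k" for k :: int
    by linarith
  ultimately show ?thesis
    unfolding rvert_def circ_eq_iff mod_eq_dvd_iff dvd_def by (simp only:)
qed

lemma inner_rvert: "rvert n l \<bullet> rvert n m = cos ((l - m) * pi / n)"
  by (simp add: rvert_def inner_circ left_diff_distrib diff_divide_distrib)

lemma rvert_mod: "rvert n (2 * (k mod int n)) = rvert n (2 * k)"
proof -
  have "2 * (k mod int n) - 2 * k = 2 * int n * - (k div int n)"
    by (simp add: minus_mult_div_eq_mod[symmetric] right_diff_distrib)
  then show ?thesis unfolding rvert_eq_iff mod_eq_dvd_iff by (metis dvd_triv_left)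
qed

lemma even_verts_eq: "even_verts n = (\<lambda>k. rvert n (2 * int k)) ` {..<n}"
proof -
  have "rvert n (2 * k) \<in> (\<lambda>k. rvert n (2 * int k)) ` {..<n}" for k :: int
  proof (rule image_eqI)
    show "rvert n (2 * k) = rvert n (2 * int (nat (k mod int n)))"
      using rvert_mod[of k] n by simp
    show "nat (k mod int n) \<in> {..<n}" using n by (simp add: nat_less_iff)
  qed
  then show ?thesis by (auto simp: even_verts_def)
qed

text \<open>The offset \<open>j\<close> serves two counts: \<open>j = 0\<close> for the vertices,
  \<open>j = 1\<close> for the rotations and reflections.\<close>

lemma inj_rvert: "inj_on (\<lambda>k. rvert n (2 * int k + j)) {..<n}"
proof (rule inj_onI)
  fix k l assume "k \<in> {..<n}" "l \<in> {..<n}" "rvert n (2 * int k + j) = rvert n (2 * int l + j)"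
  then have "2 * int k mod (2 * int n) = 2 * int l mod (2 * int n)"
    unfolding rvert_eq_iff mod_eq_dvd_iff by simp
  with \<open>k \<in> _\<close> \<open>l \<in> _\<close> show "k = l" by simp
qed

lemma card_even_verts: "card (even_verts n) = n"
  using card_image[OF inj_rvert[of 0]] by (simp add: even_verts_eq)

lemma finite_even_verts: "finite (even_verts n)"
  by (simp add: even_verts_eq)

text \<open>No odd multiple of \<open>pi / n\<close> is closer than \<open>pi / n\<close> to a
  multiple of \<open>2 * pi\<close>. This makes every vertex satisfy every edge inequality.\<close>

lemma cos_odd_le: "cos ((2 * k + 1) * pi / n) \<le> cos (pi / n)" for k :: int
proof -
  \<comment> \<open>The odd index reduced modulo \<open>2 * n\<close>; the discarded quotient
    contributes full turns.\<close>
  define m where "m = 2 * (k mod int n) + 1"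
  have "(2 * k + 1) * pi / n = m * pi / n + 2 * pi * (k div int n)"
  proof -
    have *: "(2 * (a + n * b) + 1) * pi / n = (2 * a + 1) * pi / n + 2 * pi * b" for a b :: real
      using n by (simp add: field_simps)
    have "real_of_int k = k mod int n + n * (k div int n)"
      by (metis mod_mult_div_eq of_int_add of_int_mult of_int_of_nat_eq)
    then show ?thesis
      using *[of "k mod int n" "k div int n"] by (simp only: m_def of_int_add of_int_mult of_int_1 of_int_numeral of_int_of_nat_eq)
  qed
  then have cm: "cos ((2 * k + 1) * pi / n) = cos (m * pi / n)"
    by (metis sin_cos_eq_iff)
  have "0 \<le> k mod int n" "k mod int n < int n" using n by simp_all
  then have m: "1 \<le> m" "m \<le> 2 * int n - 1" by (auto simp: m_def)
  show ?thesis
  proof (cases "m \<le> int n")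
    case True
    have "pi / n \<le> m * pi / n" using m(1) by (intro divide_right_mono) auto
    moreover have "m * pi / n \<le> pi"
    proof -
      have "real_of_int m \<le> n" using True by linarith
      then show ?thesis using n by (simp add: field_simps)
    qed
    ultimately show ?thesis
      unfolding cm using n by (intro cos_monotone_0_pi_le) auto
  next
    case False
    \<comment> \<open>An angle beyond \<open>pi\<close> is folded back by
      \<open>cos (2 * pi - y) = cos y\<close>, into the range where cosine decreases.\<close>
    define l where "l = 2 * int n - m"
    have l: "1 \<le> l" "l \<le> int n" using m False by (auto simp: l_def)
    have "m * pi / n = 2 * pi - l * pi / n" using n by (simp add: l_def field_simps)
    then have cl: "cos (m * pi / n) = cos (l * pi / n)" by simp
    have "pi / n \<le> l * pi / n" using l(1) by (intro divide_right_mono) auto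
    moreover have "l * pi / n \<le> pi"
    proof -
      have "real_of_int l \<le> n" using l by linarith
      then show ?thesis using n by (simp add: field_simps)
    qed
    ultimately show ?thesis
      unfolding cm cl using n by (intro cos_monotone_0_pi_le) auto
  qed
qed

section \<open>Half-planes, extreme points and dimension of the polygon with circumradius 1\<close>

lemma zero_in_hull: "0 \<in> convex hull even_verts n"
proof -
  let ?v = "\<lambda>k::nat. rvert n (2 * int k)"
  \<comment> \<open>Multiplying by \<open>2 * sin (pi / n)\<close> makes the sum of the vertices telescope.\<close>
  define h where "h q = (vector [sin q, - cos q] :: real^2)" for q
  define d where "d = pi / n"
  have h: "(2 * sin d) *\<^sub>R circ p = h (p + d) - h (p - d)" for p
    by (simp add: h_def circ_def vec_eq_iff forall_2 sin_add sin_diff cos_add cos_diff)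
  \<comment> \<open>The arguments lie half a step before each vertex, so \<open>g k\<close> and
    \<open>g (Suc k)\<close> flank vertex \<open>k\<close>.\<close>
  define g where "g k = h (2 * k * d - d)" for k :: nat
  have step: "(2 * sin d) *\<^sub>R ?v k = g (Suc k) - g k" for k
  proof -
    have "?v k = circ (2 * k * d)" "2 * Suc k * d - d = 2 * k * d + d"
      by (simp_all add: rvert_def d_def algebra_simps)
    then show ?thesis by (simp only: h g_def)
  qed
  have "(2 * sin d) *\<^sub>R (\<Sum>k<n. ?v k) = g n - g 0"
    by (simp add: scaleR_sum_right step sum_lessThan_telescope)
  also have "\<dots> = 0"
  proof -
    \<comment> \<open>After \<open>n\<close> steps the argument has advanced by exactly one full
      turn.\<close>
    have "2 * n * d - d = (2 * (0::nat) * d - d) + 2 * pi" using n by (simp add: d_def)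
    then show ?thesis by (simp only: g_def h_def sin_periodic cos_periodic) simp
  qed
  finally have sum0: "(\<Sum>k<n. ?v k) = 0" using sin_pos by (simp add: d_def)
  \<comment> \<open>The origin is the average of the vertices.\<close>
  have "(\<Sum>k<n. (1 / n) *\<^sub>R ?v k) \<in> convex hull even_verts n"
  proof (rule convex_sum)
    show "(\<Sum>k<n. 1 / real n) = 1" using n by simp
  qed (auto intro: hull_inc simp: even_verts_def)
  then show ?thesis by (simp add: scaleR_sum_right[symmetric] sum0)
qed

text \<open>Vertices satisfy the edge inequalities by \<open>cos_odd_le\<close>. Conversely, a point
  satisfying them lies in the sector of two consecutive vertices, and the inequality of that one
  edge puts it in the triangle they span with the origin.\<close>

lemma hull_even_verts:
  "convex hull even_verts n = {x. \<forall>w \<in> odd_verts n. x \<bullet> w \<le> cos (pi / n)}" (is "_ = ?H")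
proof
  have "even_verts n \<subseteq> ?H"
  proof clarify
    fix v w assume "v \<in> even_verts n" "w \<in> odd_verts n"
    then obtain j k where vw: "v = rvert n (2 * j)" "w = rvert n (2 * k + 1)"
      by (auto simp: even_verts_def odd_verts_def)
    \<comment> \<open>Swapping the factors gives the index difference the form
      \<open>2 * (k - j) + 1\<close>.\<close>
    have "v \<bullet> w = w \<bullet> v" by (rule inner_commute)
    also have "\<dots> = cos ((2 * real_of_int (k - j) + 1) * pi / n)"
      by (simp add: vw inner_rvert algebra_simps)
    finally show "v \<bullet> w \<le> cos (pi / n)" using cos_odd_le[of "k - j"] by simp
  qed
  moreover have "convex ?H"
  proof -
    have "?H = (\<Inter>w \<in> odd_verts n. {x. w \<bullet> x \<le> cos (pi / n)})"
      by (auto simp: inner_commute)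
    then show ?thesis by (simp add: convex_INT convex_halfspace_le)
  qed
  ultimately show "convex hull even_verts n \<subseteq> ?H" by (rule hull_minimal)
  show "?H \<subseteq> convex hull even_verts n"
  proof
    fix x assume x: "x \<in> ?H"
    obtain \<rho> t where \<rho>: "\<rho> \<ge> 0" and xt: "x = \<rho> *\<^sub>R circ t"
      by (rule polar_coordinates)
    define d where "d = pi / n"
    have d: "d > 0" "sin d > 0" "cos d > 0" "d < pi"
      using n sin_pos cos_pos by (auto simp: d_def field_simps)
    \<comment> \<open>The sector of angles from \<open>2 * k * d\<close> to
      \<open>2 * (k + 1) * d\<close> contains \<open>t\<close>.\<close>
    define k where "k = \<lfloor>t / (2 * d)\<rfloor>"
    have "of_int k \<le> t / (2 * d)" "t / (2 * d) < of_int k + 1"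
      by (simp_all add: k_def)
    \<comment> \<open>The deviation of \<open>t\<close> from the middle of the sector, which is the
      direction of the edge normal.\<close>
    define s where "s = t - (2 * k + 1) * d"
    have s: "- d \<le> s" "s \<le> d"
      using \<open>of_int k \<le> _\<close> \<open>_ < of_int k + 1\<close> d by (simp_all add: s_def field_simps)
    let ?u = "rvert n (2 * k)" and ?v = "rvert n (2 * (k + 1))"
    have u: "?u = circ (t - s - d)" and v: "?v = circ (t - s + d)"
      by (simp_all add: rvert_def s_def d_def algebra_simps add_divide_distrib)
    have in_hull: "?u \<in> convex hull even_verts n" "?v \<in> convex hull even_verts n"
      unfolding even_verts_def by (blast intro: hull_inc)+
    \<comment> \<open>Coordinates of \<open>x\<close> along the two vertices bounding the sector, by
      the sine rule for unit vectors at angle \<open>2 * d\<close>.\<close>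
    define a b where "a = \<rho> * sin (d - s) / sin (2 * d)" and "b = \<rho> * sin (d + s) / sin (2 * d)"
    have sin2: "sin (2 * d) > 0" using d by (simp add: sin_double)
    have "2 * d < pi" using n by (simp add: d_def field_simps)
    have a: "a \<ge> 0" and b: "b \<ge> 0"
      unfolding a_def b_def using \<rho> s sin2 \<open>2 * d < pi\<close>
      by (auto intro!: divide_nonneg_pos mult_nonneg_nonneg sin_ge_zero)
    have "rvert n (2 * k + 1) = circ (t - s)"
      by (simp add: rvert_def s_def d_def)
    then have "x \<bullet> rvert n (2 * k + 1) = \<rho> * cos s"
      by (simp add: xt inner_circ)
    then have "\<rho> * cos s \<le> cos d"
      using x by (metis (mono_tags, lifting) d_def mem_Collect_eq odd_verts_def rangeI)
    then have "a + b \<le> 1"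
    proof -
      \<comment> \<open>Here \<open>sin (d - s) + sin (d + s) = 2 * sin d * cos s\<close>, so the
        bound on \<open>a + b\<close> is the edge inequality divided by
        \<open>cos d\<close>.\<close>
      have "a + b = \<rho> * (2 * sin d * cos s) / sin (2 * d)"
        unfolding a_def b_def add_divide_distrib[symmetric] distrib_left[symmetric]
        by (simp add: sin_add sin_diff)
      also have "\<dots> = \<rho> * cos s / cos d"
        using d by (simp add: sin_double)
      finally show ?thesis using \<open>\<rho> * cos s \<le> cos d\<close> d by simp
    qed
    have "sin (2 * d) *\<^sub>R circ t = sin (d - s) *\<^sub>R circ (t - s - d) + sin (d + s) *\<^sub>R circ (t - s + d)"
    proof -
      \<comment> \<open>With \<open>p\<close> for \<open>t - s\<close>, every angle is a sum or
        difference of \<open>p\<close>, \<open>s\<close> and \<open>d\<close>, and the addition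
        formulas suffice.\<close>
      have *: "sin (2 * d) *\<^sub>R circ (p + s) = sin (d - s) *\<^sub>R circ (p - d) + sin (d + s) *\<^sub>R circ (p + d)" for p
        unfolding sin_double
        by (simp add: circ_def vec_eq_iff forall_2 sin_add sin_diff cos_add cos_diff algebra_simps)
      show ?thesis using *[of "t - s"] by simp
    qed
    then have "(\<rho> / sin (2 * d)) *\<^sub>R sin (2 * d) *\<^sub>R circ t = a *\<^sub>R ?u + b *\<^sub>R ?v"
      unfolding u v a_def b_def by (simp add: scaleR_add_right)
    then have "x = a *\<^sub>R ?u + b *\<^sub>R ?v" using sin2 by (simp add: xt)
    \<comment> \<open>The origin absorbs the remaining weight, giving a convex combination.\<close>
    then have "x = (1 - a - b) *\<^sub>R 0 + a *\<^sub>R ?u + b *\<^sub>R ?v" by simp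
    moreover have "(1 - a - b) *\<^sub>R 0 + a *\<^sub>R ?u + b *\<^sub>R ?v \<in> convex hull even_verts n"
    proof -
      have "(1 - a - b) *\<^sub>R 0 + a *\<^sub>R ?u + b *\<^sub>R ?v \<in> convex hull {0, ?u, ?v}"
        unfolding convex_hull_3 using a b \<open>a + b \<le> 1\<close>
        by (intro CollectI exI[of _ "1 - a - b"] exI[of _ a] exI[of _ b]) simp
      moreover have "convex hull {0, ?u, ?v} \<subseteq> convex hull even_verts n"
        using zero_in_hull in_hull by (intro hull_minimal) auto
      ultimately show ?thesis by blast
    qed
    ultimately show "x \<in> convex hull even_verts n" by simp
  qed
qed

text \<open>The polygon lies in the unit disc and its vertices on the unit circle; the tangent at a
  vertex meets the disc only there, so it is a supporting line isolating that vertex.\<close>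

lemma extreme_points_hull_even_verts:
  "{v. v extreme_point_of (convex hull even_verts n)} = even_verts n"
proof
  show "{v. v extreme_point_of (convex hull even_verts n)} \<subseteq> even_verts n"
    by (rule extreme_points_of_convex_hull)
  have "even_verts n \<subseteq> cball 0 1"
    by (auto simp: even_verts_def rvert_def)
  then have ball: "convex hull even_verts n \<subseteq> cball 0 1"
    by (rule hull_minimal) simp
  show "even_verts n \<subseteq> {v. v extreme_point_of (convex hull even_verts n)}"
  proof
    fix v assume v: "v \<in> even_verts n"
    then have nv: "norm v = 1" by (auto simp: even_verts_def rvert_def)
    have "v extreme_point_of (convex hull even_verts n)"
    proof (rule extreme_point_of_Int_supporting_hyperplane_le)
      have "x = v" if "x \<in> convex hull even_verts n" "v \<bullet> x = 1" for x
      proof -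
        have "norm x \<le> 1" using that ball by auto
        then have "(norm x)\<^sup>2 \<le> 1" by (simp add: power_le_one)
        \<comment> \<open>Equality in Cauchy-Schwarz: on the tangent this is at most
          \<open>1 - 2 + 1\<close>.\<close>
        have "(norm (x - v))\<^sup>2 = (norm x)\<^sup>2 - 2 * (v \<bullet> x) + (norm v)\<^sup>2"
          by (simp add: power2_norm_eq_inner inner_diff inner_commute)
        also have "\<dots> \<le> 0" using \<open>(norm x)\<^sup>2 \<le> 1\<close> that nv by simp
        finally show ?thesis by simp
      qed
      moreover have "v \<bullet> v = 1" using nv by (simp add: dot_square_norm)
      ultimately show "convex hull even_verts n \<inter> {x. v \<bullet> x = 1} = {v}"
        using v by (auto intro: hull_inc)
      show "v \<bullet> x \<le> 1" if "x \<in> convex hull even_verts n" for x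
      proof -
        have "v \<bullet> x \<le> norm v * norm x" by (rule norm_cauchy_schwarz)
        then show ?thesis using that ball nv by auto
      qed
    qed
    then show "v \<in> {v. v extreme_point_of (convex hull even_verts n)}" by simp
  qed
qed

text \<open>The inscribed disc of radius \<open>cos (pi / n)\<close> gives the polygon an interior
  point.\<close>

lemma aff_dim_hull_even_verts: "aff_dim (convex hull even_verts n) = 2"
proof -
  have "ball 0 (cos (pi / n)) \<subseteq> convex hull even_verts n"
  proof
    fix x :: "real^2" assume x: "x \<in> ball 0 (cos (pi / n))"
    have "x \<bullet> w \<le> cos (pi / n)" if "w \<in> odd_verts n" for w
    proof -
      have "norm w = 1" using that by (auto simp: odd_verts_def rvert_def)
      moreover have "x \<bullet> w \<le> norm x * norm w" by (rule norm_cauchy_schwarz)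
      ultimately show ?thesis using x by simp
    qed
    then show "x \<in> convex hull even_verts n" by (simp add: hull_even_verts)
  qed
  then have "0 \<in> interior (convex hull even_verts n)"
    using cos_pos by (meson centre_in_ball interior_maximal open_ball subsetD)
  then show ?thesis using aff_dim_nonempty_interior by force
qed

section \<open>The rescaled polygon and its polar\<close>

definition self_polar_radius :: real where
  "self_polar_radius = 1 / sqrt (cos (pi / n))"

definition self_polar_ngon :: "(real^2) set" where
  "self_polar_ngon = (*\<^sub>R) self_polar_radius ` (convex hull even_verts n)"

lemma self_polar_radius_pos: "self_polar_radius > 0"
  using cos_pos by (simp add: self_polar_radius_def)

text \<open>This equation determines the radius: the left side is the distance of the polygon's
  edges from the origin, the right side that of the edges of its polar.\<close>

lemma self_polar_radius_mult_cos: "self_polar_radius * cos (pi / n) = 1 / self_polar_radius"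
  using cos_pos by (simp add: self_polar_radius_def real_div_sqrt)

lemma convex_ngon_self_polar_ngon: "convex_ngon n self_polar_ngon"
proof -
  let ?f = "(*\<^sub>R) self_polar_radius :: real^2 \<Rightarrow> real^2"
  have f: "linear ?f" "inj ?f"
    using self_polar_radius_pos by (auto intro: linear_scaleR injI)
  have "polytope self_polar_ngon"
    unfolding self_polar_ngon_def
    by (intro polytope_linear_image polytope_convex_hull finite_even_verts f)
  moreover have "aff_dim self_polar_ngon = 2"
    unfolding self_polar_ngon_def
    using aff_dim_injective_linear_image[OF f] aff_dim_hull_even_verts by simp
  moreover have "{v. v extreme_point_of self_polar_ngon} = ?f ` even_verts n"
    using extreme_points_linear_image[OF f] extreme_points_hull_even_verts
    by (simp add: self_polar_ngon_def)
  then have "card {v. v extreme_point_of self_polar_ngon} = n"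
    using card_image[OF inj_on_subset[OF f(2)]] card_even_verts by simp
  ultimately show ?thesis by (simp add: convex_ngon_def)
qed

text \<open>\<open>U\<close> passes through the polar and commutes with scaling, so the image is cut
  out by one half-plane per odd direction, at distance \<open>1 / self_polar_radius\<close>. By
  \<open>hull_even_verts\<close> and the choice of radius these half-planes cut out the polygon
  itself.\<close>

lemma self_polar_ngon_eq_image_polar:
  assumes U: "orthogonal_matrix U" and odd: "(*v) U ` even_verts n = odd_verts n"
  shows "self_polar_ngon = (*v) U ` polar self_polar_ngon"
proof -
  let ?r = self_polar_radius
  note r = self_polar_radius_pos
  have orth: "orthogonal_transformation ((*v) U)"
    using U by (simp add: orthogonal_transformation_matrix matrix_vector_mul_linear)
  have "self_polar_ngon = convex hull ((*\<^sub>R) ?r ` even_verts n)"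
    by (simp add: self_polar_ngon_def convex_hull_scaling)
  then have "(*v) U ` polar self_polar_ngon = polar ((*v) U ` (*\<^sub>R) ?r ` even_verts n)"
    by (simp add: polar_convex_hull polar_orthogonal_image[OF orth])
  also have "(*v) U ` (*\<^sub>R) ?r ` even_verts n = (*\<^sub>R) ?r ` (*v) U ` even_verts n"
    by (simp add: image_image matrix_vector_mult_scaleR)
  also have "polar \<dots> = {x. \<forall>w \<in> odd_verts n. x \<bullet> w \<le> 1 / ?r}"
    unfolding odd using r by (auto simp: polar_def field_simps)
  also have "\<dots> = self_polar_ngon"
  proof -
    \<comment> \<open>Scaling back to circumradius 1 makes \<open>hull_even_verts\<close>
      applicable.\<close>
    have 1: "x \<in> self_polar_ngon \<longleftrightarrow> (1 / ?r) *\<^sub>R x \<in> convex hull even_verts n" for x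
    proof
      assume "(1 / ?r) *\<^sub>R x \<in> convex hull even_verts n"
      moreover have "x = ?r *\<^sub>R ((1 / ?r) *\<^sub>R x)" using r by simp
      ultimately show "x \<in> self_polar_ngon" unfolding self_polar_ngon_def by (rule rev_image_eqI)
    next
      assume "x \<in> self_polar_ngon"
      then obtain y where "y \<in> convex hull even_verts n" "x = ?r *\<^sub>R y"
        unfolding self_polar_ngon_def by blast
      then show "(1 / ?r) *\<^sub>R x \<in> convex hull even_verts n" using r by simp
    qed
    have 2: "(1 / ?r) * c \<le> cos (pi / n) \<longleftrightarrow> c \<le> 1 / ?r" for c
    proof -
      have "(1 / ?r) * c \<le> cos (pi / n) \<longleftrightarrow> c \<le> ?r * cos (pi / n)"
        using r by (simp add: pos_divide_le_eq mult.commute)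
      then show ?thesis by (simp only: self_polar_radius_mult_cos)
    qed
    show ?thesis
      unfolding set_eq_iff 1 hull_even_verts by (simp only: mem_Collect_eq inner_scaleR_left 2 simp_thms)
  qed
  finally show ?thesis by simp
qed

section \<open>The orthogonal maps taking even to odd directions, and their number\<close>

lemma rot_mat_image_even_verts: "(*v) (rot_mat ((2 * j + 1) * pi / n)) ` even_verts n = odd_verts n"
  for j :: int
proof -
  \<comment> \<open>The rotation adds \<open>2 * j + 1\<close> to the index, and \<open>k\<close> to
    \<open>j + k\<close> is a bijection of the integers.\<close>
  have "rot_mat ((2 * j + 1) * pi / n) *v rvert n (2 * k) = rvert n (2 * (j + k) + 1)" for k
    by (simp add: rvert_def rot_mat_circ algebra_simps add_divide_distrib)
  moreover have "range (\<lambda>k. rvert n (2 * (j + k) + 1)) = range (\<lambda>k. rvert n (2 * k + 1))"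
    using image_image[of "\<lambda>k. rvert n (2 * k + 1)" "\<lambda>k. j + k" UNIV] surj_plus[of j] by simp
  ultimately show ?thesis by (simp add: even_verts_def odd_verts_def image_image)
qed

lemma refl_mat_image_even_verts: "(*v) (refl_mat ((2 * j + 1) * pi / n)) ` even_verts n = odd_verts n"
  for j :: int
proof -
  have "refl_mat ((2 * j + 1) * pi / n) *v rvert n (2 * k) = rvert n (2 * (j - k) + 1)" for k
    by (simp add: rvert_def refl_mat_circ algebra_simps add_divide_distrib diff_divide_distrib)
  \<comment> \<open>This map of indices is its own inverse.\<close>
  moreover have "surj (\<lambda>k. j - k)" by (rule surjI[of _ "\<lambda>k. j - k"]) simp
  then have "range (\<lambda>k. rvert n (2 * (j - k) + 1)) = range (\<lambda>k. rvert n (2 * k + 1))"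
    using image_image[of "\<lambda>k. rvert n (2 * k + 1)" "\<lambda>k. j - k" UNIV] by simp
  ultimately show ?thesis by (simp add: even_verts_def odd_verts_def image_image)
qed

text \<open>The angles are the odd multiples of \<open>pi / n\<close> within one full turn.\<close>

definition odd_rots :: "(real^2^2) set" where
  "odd_rots = (\<lambda>k. rot_mat ((2 * int k + 1) * pi / n)) ` {..<n}"

definition odd_refls :: "(real^2^2) set" where
  "odd_refls = (\<lambda>k. refl_mat ((2 * int k + 1) * pi / n)) ` {..<n}"

text \<open>Each map is determined within the family by its value at \<open>circ 0\<close>, an odd
  direction, and these directions are distinct.\<close>

lemma card_odd_rots: "card odd_rots = n"
proof -
  have "inj_on (\<lambda>k. rot_mat ((2 * int k + 1) * pi / n)) {..<n}"
  proof (rule inj_onI)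
    fix k l assume kl: "k \<in> {..<n}" "l \<in> {..<n}"
      and "rot_mat ((2 * int k + 1) * pi / n) = rot_mat ((2 * int l + 1) * pi / n)"
    then have "rot_mat ((2 * int k + 1) * pi / n) *v circ 0 = rot_mat ((2 * int l + 1) * pi / n) *v circ 0"
      by simp
    then have "rvert n (2 * int k + 1) = rvert n (2 * int l + 1)"
      by (simp add: rot_mat_circ rvert_def)
    with kl show "k = l" using inj_onD[OF inj_rvert[of 1]] by blast
  qed
  then show ?thesis by (simp add: odd_rots_def card_image)
qed

text \<open>A reflection \<open>refl_mat s\<close> also sends \<open>circ 0\<close> to
  \<open>circ s\<close>, so the same evaluation distinguishes them.\<close>

lemma card_odd_refls: "card odd_refls = n"
proof -
  have "inj_on (\<lambda>k. refl_mat ((2 * int k + 1) * pi / n)) {..<n}"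
  proof (rule inj_onI)
    fix k l assume kl: "k \<in> {..<n}" "l \<in> {..<n}"
      and "refl_mat ((2 * int k + 1) * pi / n) = refl_mat ((2 * int l + 1) * pi / n)"
    then have "refl_mat ((2 * int k + 1) * pi / n) *v circ 0 = refl_mat ((2 * int l + 1) * pi / n) *v circ 0"
      by simp
    then have "rvert n (2 * int k + 1) = rvert n (2 * int l + 1)"
      by (simp add: refl_mat_circ rvert_def)
    with kl show "k = l" using inj_onD[OF inj_rvert[of 1]] by blast
  qed
  then show ?thesis by (simp add: odd_refls_def card_image)
qed

text \<open>Determinants 1 and -1 keep the two families disjoint and free of maps of the other
  type.\<close>

lemma odd_rots_Un_odd_refls:
  shows "card (odd_rots \<union> odd_refls) = 2 * n"
    and "{U \<in> odd_rots \<union> odd_refls. rotation_matrix U} = odd_rots"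
    and "{U \<in> odd_rots \<union> odd_refls. reflection_matrix U} = odd_refls"
proof -
  have rots: "rotation_matrix U" "\<not> reflection_matrix U" if "U \<in> odd_rots" for U
    using that rotation_rot_mat det_rot_mat det_reflection_matrix by (fastforce simp: odd_rots_def)+
  have refls: "\<not> rotation_matrix U" "reflection_matrix U" if "U \<in> odd_refls" for U
    using that reflection_refl_mat det_refl_mat by (auto simp: odd_refls_def rotation_matrix_def)
  have "odd_rots \<inter> odd_refls = {}" using rots refls by blast
  then show "card (odd_rots \<union> odd_refls) = 2 * n"
    using card_Un_disjoint[of odd_rots odd_refls] card_odd_rots card_odd_refls
    by (simp add: odd_rots_def odd_refls_def)
  show "{U \<in> odd_rots \<union> odd_refls. rotation_matrix U} = odd_rots"
    and "{U \<in> odd_rots \<union> odd_refls. reflection_matrix U} = odd_refls"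
    using rots refls by blast+
qed

lemma odd_rots_Un_odd_refls_self_polar:
  assumes "U \<in> odd_rots \<union> odd_refls"
  shows "orthogonal_matrix U" and "self_polar_ngon = (*v) U ` polar self_polar_ngon"
proof -
  show "orthogonal_matrix U"
    using assms orthogonal_rot_mat orthogonal_refl_mat by (auto simp: odd_rots_def odd_refls_def)
  moreover have "(*v) U ` even_verts n = odd_verts n"
    using assms unfolding odd_rots_def odd_refls_def
    by (elim UnE imageE) (simp_all only: rot_mat_image_even_verts refl_mat_image_even_verts)
  ultimately show "self_polar_ngon = (*v) U ` polar self_polar_ngon"
    by (rule self_polar_ngon_eq_image_polar)
qed

end

theorem theorem4p1:
  fixes n :: nat
  assumes "n \<ge> 3"
  shows "\<exists>(P :: (real^2) set) (T :: (real^2^2) set).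
           convex_ngon n P \<and>
           card T = 2 * n \<and>
           card {U \<in> T. rotation_matrix U} = n \<and>
           card {U \<in> T. reflection_matrix U} = n \<and>
           (\<forall>U\<in>T. orthogonal_matrix U \<and> P = (\<lambda>x. U *v x) ` polar P)"
proof (intro exI conjI ballI)
  show "convex_ngon n (self_polar_ngon n)"
    by (rule convex_ngon_self_polar_ngon[OF assms])
  show "card (odd_rots n \<union> odd_refls n) = 2 * n"
    by (rule odd_rots_Un_odd_refls[OF assms])
  show "card {U \<in> odd_rots n \<union> odd_refls n. rotation_matrix U} = n"
    by (simp only: odd_rots_Un_odd_refls[OF assms] card_odd_rots[OF assms])
  show "card {U \<in> odd_rots n \<union> odd_refls n. reflection_matrix U} = n"
    by (simp only: odd_rots_Un_odd_refls[OF assms] card_odd_refls[OF assms])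
  fix U assume "U \<in> odd_rots n \<union> odd_refls n"
  from odd_rots_Un_odd_refls_self_polar[OF assms this]
  show "orthogonal_matrix U" and "self_polar_ngon n = (\<lambda>x. U *v x) ` polar (self_polar_ngon n)"
    by simp_all
qed

end
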